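(* For every positive integer $k$ and for all $a,b\in[0,\infty)$ we have $$\sum_{j=0}^{k} \binom{k}{j}^2 a^{p_k(k-j)/k}\, b^{p_k j/k} \leq (a+b)^{p_k},$$ where $p_k=\log_2\binom{2k}{k}$.
   Context: Powers are real powers of nonnegative real numbers, with the convention $0^0=1$. *)

theory Defs
  imports Complex_Main
begin

text \<open>
  Real powers of nonnegative reals with the convention that zero to the power zero is one;
  the library's \<open>powr\<close> instead has \<open>0 powr 0 = 0\<close>. The two agree everywhere else,
  and \<open>rpow\<close> is only meant for \<open>x \<ge> 0\<close>.
\<close>

definition rpow :: "real \<Rightarrow> real \<Rightarrow> real" where
  "rpow x y = (if x = 0 \<and> y = 0 then 1 else x powr y)"

definition binom_exponent :: "nat \<Rightarrow> real" where
  "binom_exponent k = log 2 (real ((2 * k) choose k))"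

end

theory Submission
  imports Defs "HOL-Computational_Algebra.Polynomial"
begin

text \<open>
  Let \<open>p = log 2 ((2 * k) choose k)\<close>. By homogeneity and symmetry take \<open>a = 1\<close> and \<open>b \<le> 1\<close>, and put
  \<open>t = b powr (p / k)\<close>, \<open>P t = (\<Sum>j\<le>k. (k choose j)^2 * t^j)\<close> and \<open>m = 1 - k / p\<close>, so that \<open>0 < m < 1/2\<close> when
  \<open>k \<ge> 2\<close>. Pascal's rule splits \<open>P t = A t + t * B t\<close> with \<open>P' = k * B\<close>, and the defect \<open>G t = p * ln (1 + t powr (1 - m)) - ln (P t)\<close>, which vanishes at
  \<open>0\<close> and \<open>1\<close>, has derivative of sign opposite to \<open>f t = t powr m * B t - A t\<close>.
  If \<open>G\<close> were negative somewhere, \<open>f\<close>, which is negative at \<open>0\<close>, would change sign upwards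
  and later downwards in \<open>(0, 1)\<close>. The first order differential relations between \<open>A\<close> and \<open>B\<close>
  (a Riccati equation for \<open>B / A\<close>) show that at a zero of \<open>f\<close> the derivative \<open>f'\<close> has the sign of
  \<open>k * (t powr m - t powr (1 - m)) - (1 - m) * (1 - t)\<close>, a strictly concave function
  vanishing at \<open>1\<close>, which excludes this pattern.
\<close>

section \<open>Zeros where a function crosses upwards\<close>

text \<open>Take for \<open>x\<close> the largest point with \<open>f x \<le> 0\<close>. Beyond it
  \<open>f\<close> is positive, so a negative value at \<open>x\<close> contradicts the intermediate
  value theorem, and a negative derivative would make \<open>f\<close> negative just to the
  right.\<close>

lemma up_crossing:
  fixes f f' :: "real \<Rightarrow> real"
  assumes ab: "a \<le> b" and cont: "continuous_on {a..b} f"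
    and der: "\<And>x. a < x \<Longrightarrow> x < b \<Longrightarrow> (f has_real_derivative f' x) (at x)"
    and fa: "f a < 0" and fb: "f b > 0"
  obtains x where "a < x" "x < b" "f x = 0" "f' x \<ge> 0"
proof -
  define S where "S = {a..b} \<inter> f -` {..0}"
  have "closed S"
    using cont continuous_on_closed_vimage[of "{a..b}" f] unfolding S_def
    by (metis Int_commute closed_atLeastAtMost closed_atMost)
  then have "compact ({a..b} \<inter> S)" by (intro compact_Int_closed) auto
  then have "compact S" by (simp add: S_def)
  moreover have "a \<in> S" using ab fa by (auto simp: S_def)
  ultimately obtain x where x: "x \<in> S" and xmax: "\<And>y. y \<in> S \<Longrightarrow> y \<le> x"
    by (metis compact_attains_sup empty_iff)
  have xab: "a \<le> x" "x \<le> b" "f x \<le> 0" using x by (auto simp: S_def)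
  have pos: "f y > 0" if "x < y" "y \<le> b" for y
    using xmax[of y] that xab by (force simp: S_def)
  have "x < b" using xab fb by (cases "x = b") auto
  have "f x = 0"
  proof (rule ccontr)
    assume "f x \<noteq> 0"
    then have "f x < 0" using xab by simp
    have "continuous_on {x..b} f" using cont xab continuous_on_subset by fastforce
    then obtain y where "x \<le> y" "y \<le> b" "f y = f x / 2"
      using IVT'[of f x "f x / 2" b] \<open>f x < 0\<close> fb xab by auto
    then show False using pos[of y] \<open>f x < 0\<close> by (cases "x = y") auto
  qed
  have "a < x" using \<open>f x = 0\<close> fa xab by (cases "a = x") auto
  have "f' x \<ge> 0"
  proof (rule ccontr)
    assume "\<not> f' x \<ge> 0"
    then obtain d where d: "d > 0" "\<And>h. 0 < h \<Longrightarrow> h < d \<Longrightarrow> f (x + h) < f x"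
      using DERIV_neg_dec_right[OF der[OF \<open>a < x\<close> \<open>x < b\<close>]] by auto
    define h where "h = min (d / 2) (b - x)"
    have "0 < h" "h < d" "x + h \<le> b" using d \<open>x < b\<close> by (auto simp: h_def min_def)
    then show False using d(2)[of h] pos[of "x + h"] \<open>f x = 0\<close> by auto
  qed
  then show thesis using that \<open>a < x\<close> \<open>x < b\<close> \<open>f x = 0\<close> by blast
qed

section \<open>The polynomials \<open>A\<close>, \<open>B\<close>, \<open>P\<close> and their
  differential relations\<close>

text \<open>This is \<open>A\<close> for \<open>k = Suc n\<close>: Pascal's rule applied to one
  factor of \<open>(k choose j)^2\<close> leaves the share \<open>n choose j\<close> here.\<close>

definition lower_poly :: "nat \<Rightarrow> real poly" where
  "lower_poly n = (\<Sum>j\<le>n. monom (real ((Suc n choose j) * (n choose j))) j)"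

text \<open>This is \<open>B\<close>, collecting the other share of Pascal's rule. That share starts
  at degree one, so a factor \<open>t\<close> is taken out and the index is shifted.\<close>

definition upper_poly :: "nat \<Rightarrow> real poly" where
  "upper_poly n = (\<Sum>j\<le>n. monom (real ((Suc n choose Suc j) * (n choose j))) j)"

definition square_poly :: "nat \<Rightarrow> real poly" where
  "square_poly k = (\<Sum>j\<le>k. monom ((real (k choose j))\<^sup>2) j)"

lemma coeff_lower_poly [simp]:
  "coeff (lower_poly n) j = real ((Suc n choose j) * (n choose j))"
  by (auto simp: lower_poly_def coeff_sum if_distrib sum.delta)

lemma coeff_upper_poly [simp]:
  "coeff (upper_poly n) j = real ((Suc n choose Suc j) * (n choose j))"
  by (auto simp: upper_poly_def coeff_sum if_distrib sum.delta)

lemma coeff_square_poly [simp]: "coeff (square_poly k) j = (real (k choose j))\<^sup>2"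
  by (auto simp: square_poly_def coeff_sum if_distrib sum.delta)

lemma square_poly_split: "square_poly (Suc n) = lower_poly n + pCons 0 (upper_poly n)"
  by (rule poly_eqI)
     (auto simp: coeff_pCons power2_eq_square algebra_simps split: nat.split)

lemma pderiv_square_poly: "pderiv (square_poly (Suc n)) = smult (real (Suc n)) (upper_poly n)"
proof (rule poly_eqI)
  fix j
  have "real (Suc j) * real (Suc n choose Suc j) = real (Suc n) * real (n choose j)"
    by (metis Suc_times_binomial_eq of_nat_mult mult.commute)
  then show "coeff (pderiv (square_poly (Suc n))) j = coeff (smult (real (Suc n)) (upper_poly n)) j"
    by (simp add: coeff_pderiv power2_eq_square del: binomial_Suc_Suc of_nat_Suc)
qed

lemma binomial_absorb_upper:
  "real (Suc j) * real (Suc n choose Suc j) = (real (Suc n) - real j) * real (Suc n choose j)"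
proof (cases "j \<le> Suc n")
  case True
  then show ?thesis
    by (metis binomial_absorb_comp binomial_absorption mult.commute of_nat_diff of_nat_mult
        diff_Suc_1)
next
  case False then show ?thesis by (simp add: binomial_eq_0)
qed

text \<open>The relation \<open>(1 - t) * A' = k * (B - A)\<close>. In each coefficient, absorption
  turns both \<open>(j + 1) * (k choose (j + 1))\<close> and \<open>(k - j) * (k choose j)\<close>
  into \<open>k * (n choose j)\<close>.\<close>

lemma pderiv_lower_poly:
  "pderiv (lower_poly n) - pCons 0 (pderiv (lower_poly n))
    = smult (real (Suc n)) (upper_poly n - lower_poly n)"
proof (rule poly_eqI)
  fix j
  have 1: "real (Suc j) * real (Suc n choose Suc j) = real (Suc n) * real (n choose j)"
    by (metis Suc_times_binomial_eq of_nat_mult mult.commute)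
  have 2: "(real (Suc n) - real j) * real (Suc n choose j) = real (Suc n) * real (n choose j)"
    using 1 binomial_absorb_upper by simp
  have 3: "real (Suc n choose Suc j) = real (n choose j) + real (n choose Suc j)" by simp
  have "coeff (pCons 0 (pderiv (lower_poly n))) j = real j * coeff (lower_poly n) j"
    by (cases j) (simp_all add: coeff_pderiv)
  moreover have "real (Suc j) * (real (Suc n choose Suc j) * real (n choose Suc j))
     - real j * (real (Suc n choose j) * real (n choose j))
     = real (Suc n) * (real (Suc n choose Suc j) * real (n choose j)
          - real (Suc n choose j) * real (n choose j))"
    using 1 2 3 by algebra
  ultimately show "coeff (pderiv (lower_poly n) - pCons 0 (pderiv (lower_poly n))) j
    = coeff (smult (real (Suc n)) (upper_poly n - lower_poly n)) j"
    by (simp add: coeff_pderiv del: binomial_Suc_Suc of_nat_Suc)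
qed

text \<open>The relation \<open>t * (A' + B') + B = k * A\<close>. After removing
  \<open>n choose j\<close>, the coefficients are
  \<open>j * (k choose j) + (j + 1) * (k choose (j + 1))\<close>, where the second term is
  \<open>(k - j) * (k choose j)\<close>.\<close>

lemma pderiv_lower_upper_poly:
  "pCons 0 (pderiv (lower_poly n) + pderiv (upper_poly n)) + upper_poly n
    = smult (real (Suc n)) (lower_poly n)"
proof (rule poly_eqI)
  fix j
  have "coeff (pCons 0 (pderiv (lower_poly n) + pderiv (upper_poly n))) j
     = real j * (coeff (lower_poly n) j + coeff (upper_poly n) j)"
    by (cases j) (simp_all add: coeff_pderiv algebra_simps)
  moreover have "real j * (real (Suc n choose j) * real (n choose j)
      + real (Suc n choose Suc j) * real (n choose j)) + real (Suc n choose Suc j) * real (n choose j)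
      = real (Suc n) * (real (Suc n choose j) * real (n choose j))"
    using binomial_absorb_upper[of j n] unfolding of_nat_Suc[of j] by algebra
  ultimately show "coeff (pCons 0 (pderiv (lower_poly n) + pderiv (upper_poly n)) + upper_poly n) j
      = coeff (smult (real (Suc n)) (lower_poly n)) j"
    by (simp del: binomial_Suc_Suc of_nat_Suc)
qed

lemma poly_pos_of_coeffs:
  fixes p :: "real poly"
  assumes "\<And>j. coeff p j \<ge> 0" "coeff p 0 > 0" "t \<ge> 0"
  shows "poly p t > 0"
proof -
  have "0 < coeff p 0 * t ^ 0" using assms by simp
  also have "\<dots> \<le> (\<Sum>i\<le>degree p. coeff p i * t ^ i)"
    by (rule member_le_sum) (use assms in auto)
  finally show ?thesis by (simp add: poly_altdef)
qed

section \<open>The concave sign function and the range of the exponent\<close>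

text \<open>Since \<open>K 1 = 0\<close>, having \<open>K x \<ge> 0\<close> and
  \<open>K y \<le> 0\<close> would give a secant slope at most \<open>0\<close> on
  \<open>[x, y]\<close> and at least \<open>0\<close> on \<open>[y, 1]\<close>, against strict
  concavity.\<close>

lemma concave_profile_no_return:
  fixes c m :: real
  defines "K \<equiv> (\<lambda>t. c * (t powr m - t powr (1 - m)) - (1 - m) * (1 - t))"
  assumes c: "c > 0" and m: "0 < m" "m < 1/2" and xy: "0 < x" "x < y" "y < 1"
    and Kx: "K x \<ge> 0"
  shows "K y > 0"
proof (rule ccontr)
  assume Ky: "\<not> K y > 0"
  define K' where "K' = (\<lambda>t. c * (m * t powr (m - 1) - (1 - m) * t powr (- m)) + (1 - m))"
  define K'' where "K'' = (\<lambda>t. c * (m * (1 - m)) * (t powr (- m - 1) - t powr (m - 2)))"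
  have dK: "(K has_real_derivative K' t) (at t)" if "t > 0" for t
    unfolding K_def K'_def using that
    by (auto intro!: derivative_eq_intros simp: algebra_simps)
  have dK': "(K' has_real_derivative K'' t) (at t)" if "t > 0" for t
    unfolding K''_def K'_def using that
    by (auto intro!: derivative_eq_intros simp: algebra_simps)
  have K''neg: "K'' t < 0" if "0 < t" "t < 1" for t
  proof -
    \<comment> \<open>Here \<open>m < 1/2\<close> enters: it makes \<open>- m - 1\<close> the larger
      exponent, and the base is below \<open>1\<close>.\<close>
    have "t powr (- m - 1) < t powr (m - 2)"
      using that m by (intro powr_less_mono') auto
    then show ?thesis unfolding K''_def using c m by (intro mult_pos_neg) auto
  qed
  obtain u where u: "x < u" "u < y" "K y - K x = (y - x) * K' u"
    using MVT2[of x y K K'] xy dK by (smt (verit))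
  obtain v where v: "y < v" "v < 1" "K 1 - K y = (1 - y) * K' v"
    using MVT2[of y 1 K K'] xy dK by (smt (verit))
  have "(y - x) * K' u \<le> 0" using u Kx Ky by simp
  then have u0: "K' u \<le> 0" using xy by (simp add: mult_le_0_iff)
  have "K 1 = 0" by (simp add: K_def)
  then have "(1 - y) * K' v \<ge> 0" using v Ky by simp
  then have v0: "K' v \<ge> 0" using xy by (simp add: zero_le_mult_iff)
  have "K' v < K' u"
  proof (rule DERIV_neg_imp_decreasing[of u v K'])
    show "u < v" using u v by simp
    fix t assume "u \<le> t" "t \<le> v"
    then have "0 < t" "t < 1" using u v xy by auto
    then show "\<exists>z. DERIV K' t :> z \<and> z < 0" using dK' K''neg by blast
  qed
  then show False using u0 v0 by simp
qed

text \<open>These bounds become \<open>k < p < 2 * k\<close>, that is \<open>0 < m < 1/2\<close>.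
  The lower one compares the sum of the squares of row \<open>k\<close> with its plain sum; the
  upper one uses that row \<open>2 * k\<close> has further positive entries.\<close>

lemma central_binomial_bounds:
  assumes "k \<ge> 2"
  shows "2 ^ k < (2 * k) choose k" "(2 * k) choose k < 4 ^ k"
proof -
  have sq: "(2 * k) choose k = (\<Sum>j\<le>k. (k choose j)\<^sup>2)"
    using choose_square_sum[of k] by simp
  have "(\<Sum>j\<le>k. k choose j) < (\<Sum>j\<le>k. (k choose j)\<^sup>2)"
  proof (rule sum_strict_mono_ex1)
    show "\<forall>j\<in>{..k}. k choose j \<le> (k choose j)\<^sup>2"
      by (simp add: power2_eq_square Suc_le_eq)
    show "\<exists>j\<in>{..k}. k choose j < (k choose j)\<^sup>2"
      using assms by (intro bexI[of _ 1]) (auto simp: power2_eq_square)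
  qed auto
  then show "2 ^ k < (2 * k) choose k" by (simp add: sq choose_row_sum)
  have "(2 * k) choose k < ((2 * k) choose 0) + ((2 * k) choose k)" by simp
  also have "\<dots> = (\<Sum>j\<in>{0, k}. (2 * k) choose j)" using assms by simp
  also have "\<dots> \<le> (\<Sum>j\<le>2 * k. (2 * k) choose j)" by (rule sum_mono2) auto
  also have "\<dots> = 4 ^ k" by (simp add: choose_row_sum power_mult)
  finally show "(2 * k) choose k < 4 ^ k" .
qed

lemma binom_exponent_pos: "k \<ge> 2 \<Longrightarrow> binom_exponent k > 0"
  using le_less_trans[OF one_le_power central_binomial_bounds(1), of k]
  by (simp add: binom_exponent_def)

lemma poly_lower_pos: "t \<ge> 0 \<Longrightarrow> poly (lower_poly n) t > 0"
  and poly_upper_pos: "t \<ge> 0 \<Longrightarrow> poly (upper_poly n) t > 0"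
  by (rule poly_pos_of_coeffs; simp del: binomial_Suc_Suc)+

lemma poly_square_poly: "poly (square_poly k) t = (\<Sum>j\<le>k. (real (k choose j))\<^sup>2 * t ^ j)"
  by (simp add: square_poly_def poly_sum poly_monom)

section \<open>The one-variable inequality\<close>

text \<open>The factor \<open>(1 - t) * t\<close>, positive on \<open>(0, 1)\<close>, clears the
  denominators of \<open>A'\<close> and \<open>B'\<close>; the two relations then eliminate both
  derivatives, and the zero of \<open>f\<close> eliminates \<open>B\<close>.\<close>

lemma ratio_deriv_at_crossing:
  fixes t m :: real and n :: nat
  defines "A \<equiv> poly (lower_poly n)" and "B \<equiv> poly (upper_poly n)"
    and "A' \<equiv> poly (pderiv (lower_poly n))" and "B' \<equiv> poly (pderiv (upper_poly n))"
  assumes t: "0 < t" and zero: "t powr m * B t = A t"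
  shows "(1 - t) * t * (m * t powr (m - 1) * B t + t powr m * B' t - A' t)
    = A t * (real (Suc n) * (t powr m - t powr (1 - m)) - (1 - m) * (1 - t))"
proof -
  define k where "k = real (Suc n)"
  define w where "w = t powr m"
  have eA: "(1 - t) * A' t = k * (B t - A t)"
    using arg_cong[OF pderiv_lower_poly[of n], of "\<lambda>p. poly p t"]
    by (simp add: A_def B_def A'_def k_def algebra_simps)
  have eB: "t * (A' t + B' t) + B t = k * A t"
    using arg_cong[OF pderiv_lower_upper_poly[of n], of "\<lambda>p. poly p t"]
    by (simp add: A_def B_def A'_def B'_def k_def algebra_simps)
  have p1: "t * t powr (m - 1) = w"
    using t powr_mult_base[of t "m - 1"] by (simp add: w_def)
  have p2: "w * t powr (1 - m) = t"
    using t by (simp add: w_def flip: powr_add)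
  have p3: "A t * t powr (1 - m) = t * B t"
    using p2 by (simp add: w_def mult.commute mult.left_commute flip: zero)
  have "(1 - t) * t * (m * t powr (m - 1) * B t + w * B' t - A' t)
     = m * (1 - t) * (w * B t) + w * ((1 - t) * (t * B' t)) - t * ((1 - t) * A' t)"
    by (simp add: algebra_simps flip: p1)
  also have "(1 - t) * (t * B' t) = k * A t - (1 + (k - 1) * t) * B t"
    using eA eB by algebra
  also have "m * (1 - t) * (w * B t) + w * (k * A t - (1 + (k - 1) * t) * B t) - t * ((1 - t) * A' t)
     = A t * (k * (w - t powr (1 - m)) - (1 - m) * (1 - t))"
    using eA zero[folded w_def] p3 by algebra
  finally show ?thesis by (simp add: w_def k_def)
qed

lemma square_poly_le:
  fixes t :: real and n :: nat
  assumes n: "n \<ge> 1" and t: "0 \<le> t" "t \<le> 1"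
  defines "p \<equiv> binom_exponent (Suc n)"
  shows "poly (square_poly (Suc n)) t \<le> (1 + t powr (real (Suc n) / p)) powr p"
proof -
  define k where "k = real (Suc n)"
  define C where "C = real ((2 * Suc n) choose Suc n)"
  define m where "m = 1 - k / p"
  define A where "A = poly (lower_poly n)"
  define B where "B = poly (upper_poly n)"
  define P where "P = poly (square_poly (Suc n))"
  have "real (2 ^ Suc n) < C" "C < real (4 ^ Suc n)"
    unfolding C_def of_nat_less_iff by (rule central_binomial_bounds; use n in simp)+
  moreover have "2 powr k = 2 ^ Suc n" "4 powr k = 4 ^ Suc n"
    unfolding k_def by (rule powr_realpow; simp)+
  moreover have "2 powr (2 * k) = 4 powr k"
    using powr_powr[of 2 2 k] by simp
  ultimately have C: "2 powr k < C" "C < 2 powr (2 * k)"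
    by (simp_all only: of_nat_power of_nat_numeral)
  then have "C > 0" using powr_gt_zero[of 2 k] by linarith
  have p_eq: "p = log 2 C" by (simp add: p_def C_def binom_exponent_def)
  have pk: "k < p" "p < 2 * k"
    using C \<open>C > 0\<close> by (simp_all add: p_eq less_log_iff log_less_iff)
  have k0: "k > 0" by (simp add: k_def)
  have m: "0 < m" "m < 1/2" and pm: "p * (1 - m) = k"
    using pk k0 by (auto simp: m_def field_simps)
  have pos: "A s > 0" "B s > 0" if "s \<ge> 0" for s
    using that by (simp_all add: A_def B_def poly_lower_pos poly_upper_pos)
  have P_eq: "P s = A s + s * B s" for s
    by (simp add: P_def A_def B_def square_poly_split)
  have Ppos: "P s > 0" if "s \<ge> 0" for s
    using pos[OF that] that by (simp add: P_eq add_pos_nonneg)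
  have dP: "(P has_real_derivative k * B s) (at s)" for s
    using poly_DERIV[of "square_poly (Suc n)" s] by (simp add: P_def B_def k_def pderiv_square_poly)
  define f where "f = (\<lambda>s. s powr m * B s - A s)"
  define f' where "f' = (\<lambda>s. m * s powr (m - 1) * B s
     + s powr m * poly (pderiv (upper_poly n)) s - poly (pderiv (lower_poly n)) s)"
  have df: "(f has_real_derivative f' s) (at s)" if "s > 0" for s
    unfolding f_def f'_def A_def B_def using that
    by (auto intro!: derivative_eq_intros poly_DERIV simp: algebra_simps)
  have cf: "continuous_on S f" if "S \<subseteq> {0..}" for S
    unfolding f_def A_def B_def using that m
    by (intro continuous_intros continuous_on_powr') auto
  define G where "G = (\<lambda>s. p * ln (1 + s powr (1 - m)) - ln (P s))"
  define G' where "G' = (\<lambda>s. - (k * s powr (- m) / ((1 + s powr (1 - m)) * P s)) * f s)"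
  have dG: "(G has_real_derivative G' s) (at s)" if "s > 0" for s
  proof -
    \<comment> \<open>In terms of \<open>u\<close> all powers of \<open>s\<close> become rational,
      so the rest is algebra.\<close>
    define u where "u = s powr (- m)"
    have u: "s powr (1 - m) = s * u" "u * s powr m = 1" "u > 0"
      using that powr_mult_base[of s "- m"] by (auto simp: u_def simp flip: powr_add)
    have "1 + s * u > 0" using u that by (simp add: add_pos_nonneg)
    have "(G has_real_derivative
        p * ((1 - m) * u / (1 + s powr (1 - m))) - k * B s / P s) (at s)"
      unfolding G_def u_def using that Ppos[of s] dP
      by (auto intro!: derivative_eq_intros simp: add_pos_nonneg)
    also have "p * ((1 - m) * u / (1 + s powr (1 - m))) - k * B s / P s
       = k * (u / (1 + s * u) - B s / P s)"
      unfolding pm[symmetric] u(1) by (simp add: right_diff_distrib mult.assoc)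
    also have "u / (1 + s * u) - B s / P s = (u * P s - B s * (1 + s * u)) / ((1 + s * u) * P s)"
      using Ppos[of s] that \<open>1 + s * u > 0\<close> by (simp add: divide_simps)
    also have "u * P s - B s * (1 + s * u) = - u * f s"
      using u(2) unfolding P_eq f_def by algebra
    finally show ?thesis by (simp add: G'_def u u_def mult.assoc)
  qed
  have cG: "continuous_on S G" if "S \<subseteq> {0..}" for S
  proof -
    have "1 + s powr (1 - m) \<noteq> 0" "P s \<noteq> 0" if "s \<in> S" for s
      using Ppos[of s] that \<open>S \<subseteq> {0..}\<close> powr_ge_zero[of s "1 - m"] by (auto simp del: powr_ge_zero)
    moreover have "continuous_on S P" by (simp add: P_def continuous_on_poly)
    ultimately show ?thesis
      unfolding G_def using m that
      by (intro continuous_intros continuous_on_powr') auto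
  qed
  have sG: "f s > 0 \<longleftrightarrow> G' s < 0" "f s < 0 \<longleftrightarrow> G' s > 0" if "s > 0" for s
  proof -
    define c where "c = k * s powr (- m) / ((1 + s powr (1 - m)) * P s)"
    have "G' s = - (c * f s)" by (simp add: G'_def c_def)
    moreover have "c > 0"
      unfolding c_def using k0 that Ppos[of s] by (intro divide_pos_pos mult_pos_pos add_pos_nonneg) auto
    ultimately show "f s > 0 \<longleftrightarrow> G' s < 0" "f s < 0 \<longleftrightarrow> G' s > 0"
      by (simp_all add: zero_less_mult_iff mult_less_0_iff)
  qed
  \<comment> \<open>Equality at \<open>1\<close> is what fixes the exponent: the squares sum to
    \<open>C\<close>, and \<open>2 powr p = C\<close>.\<close>
  have P1: "P 1 = C"
    using choose_square_sum[of "Suc n"] unfolding P_def poly_square_poly C_def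
    by (simp flip: of_nat_power of_nat_sum del: binomial_Suc_Suc sum.atMost_Suc)
  have "P 0 = 1" by (simp add: P_def poly_0_coeff_0)
  then have G0: "G 0 = 0" using m by (simp add: G_def)
  have G1: "G 1 = 0" using \<open>C > 0\<close> by (simp add: G_def P1 p_eq log_def)
  have "G t \<ge> 0"
  proof (rule ccontr)
    assume "\<not> G t \<ge> 0"
    then have Gt: "G t < 0" by simp
    then have t01: "0 < t" "t < 1" using t G0 G1 by (cases "t = 0"; cases "t = 1"; simp)+
    \<comment> \<open>At \<open>0\<close> only continuity of \<open>G\<close> has been shown, so the
      form of the mean value theorem with derivatives in the interior is used here.\<close>
    have "\<exists>l z. 0 < z \<and> z < t \<and> DERIV G z :> l \<and> G t - G 0 = (t - 0) * l"
      using t01 dG cG by (intro MVT) (auto simp: real_differentiable_def)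
    then obtain a where a: "0 < a" "a < t" "G t - G 0 = t * G' a"
      using dG DERIV_unique by fastforce
    then have "G' a < 0" using Gt G0 t01 by (simp add: mult_less_0_iff)
    then have fa: "f a > 0" using sG a by simp
    obtain b where b: "t < b" "b < 1" "G 1 - G t = (1 - t) * G' b"
      using MVT2[of t 1 G G'] t01 dG by (smt (verit))
    then have "(1 - t) * G' b > 0" using Gt G1 by simp
    then have "G' b > 0" using t01 by (simp add: zero_less_mult_iff)
    then have fb: "f b < 0" using sG b t01 by simp
    \<comment> \<open>Since \<open>0 powr m = 0\<close>, only \<open>- A 0\<close> remains.\<close>
    have "f 0 < 0" using pos[of 0] by (simp add: f_def)
    then obtain x where x: "0 < x" "x < a" "f x = 0" "f' x \<ge> 0"
      using up_crossing[of 0 a f f'] fa a df cf[of "{0..a}"] by auto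
    have "continuous_on {a..b} (\<lambda>s. - f s)"
      using cf[of "{a..b}"] a by (intro continuous_on_minus) auto
    moreover have "((\<lambda>s. - f s) has_real_derivative - f' s) (at s)" if "a < s" for s
      using df that a by (intro DERIV_minus) auto
    ultimately obtain y where y: "a < y" "y < b" "- f y = 0" "- f' y \<ge> 0"
      using up_crossing[of a b "\<lambda>s. - f s" "\<lambda>s. - f' s"] fa fb a b by auto
    define K where "K = (\<lambda>s. k * (s powr m - s powr (1 - m)) - (1 - m) * (1 - s))"
    have K: "(1 - s) * s * f' s = A s * K s" if "s > 0" "f s = 0" for s
      using ratio_deriv_at_crossing[of s m n] that
      by (simp add: f_def f'_def A_def B_def K_def k_def)
    have x1: "x < 1" and y1: "0 < y" "y < 1" "x < y" using x y a b by auto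
    \<comment> \<open>The upward crossing gives \<open>K x \<ge> 0\<close>, which forces
      \<open>K y > 0\<close> and so \<open>f' y > 0\<close>, whereas \<open>f\<close> crosses
      downwards at \<open>y\<close>.\<close>
    have "A x * K x \<ge> 0" using K[of x] x x1 by (simp flip: K)
    then have "K x \<ge> 0" using pos(1)[of x] x by (simp add: zero_le_mult_iff)
    then have "K y > 0"
      using concave_profile_no_return[of k m x y] k0 m x y1 by (simp add: K_def)
    then have "(1 - y) * y * f' y > 0" using K[of y] y y1 pos(1)[of y] by simp
    then show False using y y1 by (simp add: zero_less_mult_iff mult_less_0_iff)
  qed
  then have "ln (P t) \<le> p * ln (1 + t powr (1 - m))" by (simp add: G_def)
  then have "P t \<le> exp (p * ln (1 + t powr (1 - m)))"
    using Ppos[OF t(1)] by (metis exp_le_cancel_iff exp_ln)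
  also have "\<dots> = (1 + t powr (1 - m)) powr p"
    using powr_ge_zero[of t "1 - m"] by (auto simp: powr_def)
  finally show ?thesis by (simp add: P_def m_def k_def)
qed

section \<open>Homogeneity and symmetry\<close>

lemma rpow_nonneg: "rpow x y \<ge> 0"
  by (simp add: rpow_def)

text \<open>For \<open>b = 0\<close> the convention \<open>0^0 = 1\<close> matters: at
  \<open>j = 0\<close> both sides are \<open>1\<close>, as the outer power on the right has a
  natural exponent.\<close>

lemma rpow_scale:
  assumes "a > 0" "b \<ge> 0" "e > 0"
  shows "rpow b (e * real j) = a powr (e * real j) * ((b / a) powr e) ^ j"
proof (cases "b = 0")
  case True
  then show ?thesis using assms by (cases "j = 0") (auto simp: rpow_def)
next
  case False
  then have "((b / a) powr e) ^ j = (b / a) powr (e * real j)"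
    using assms by (simp add: powr_powr flip: powr_realpow)
  then show ?thesis using assms False by (simp add: rpow_def powr_divide)
qed

text \<open>Both sides are homogeneous of degree \<open>p\<close>: factoring out
  \<open>a powr p\<close> leaves the one-variable inequality at
  \<open>t = (b / a) powr (p / k)\<close>, and \<open>b \<le> a\<close> gives
  \<open>t \<le> 1\<close>.\<close>

lemma sum_rpow_le_of_le:
  fixes a b :: real and n :: nat
  defines "k \<equiv> Suc n"
  defines "p \<equiv> binom_exponent k"
  assumes n: "n \<ge> 1" and ab: "0 \<le> b" "b \<le> a" "a > 0"
  shows "(\<Sum>j = 0..k. (real (k choose j))\<^sup>2 * rpow a (p * (real k - real j) / real k)
            * rpow b (p * real j / real k)) \<le> rpow (a + b) p"
proof -
  have p: "p > 0" using n by (simp add: p_def k_def binom_exponent_pos)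
  have k: "real k > 0" by (simp add: k_def)
  define e where "e = p / real k"
  have e: "e > 0" "p = e * real k" using p k by (simp_all add: e_def)
  define t where "t = (b / a) powr e"
  have t: "0 \<le> t" "t \<le> 1" using ab e by (auto simp: t_def intro!: powr_le1)
  have tb: "t powr (real k / p) = b / a"
    using ab p k by (simp add: t_def powr_powr e_def)
  have "(real (k choose j))\<^sup>2 * rpow a (p * (real k - real j) / real k)
            * rpow b (p * real j / real k) = a powr p * ((real (k choose j))\<^sup>2 * t ^ j)" for j
  proof -
    have "rpow b (p * real j / real k) = a powr (e * real j) * t ^ j"
      using rpow_scale[of a b e j] ab e(1) by (simp add: t_def e_def)
    moreover have "rpow a (p * (real k - real j) / real k) = a powr (e * (real k - real j))"
      using ab by (simp add: rpow_def e_def)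
    moreover have "a powr (e * (real k - real j)) * a powr (e * real j) = a powr p"
      using e(2) by (simp add: algebra_simps flip: powr_add)
    ultimately show ?thesis by (metis (no_types) mult.assoc mult.left_commute)
  qed
  then have "(\<Sum>j = 0..k. (real (k choose j))\<^sup>2 * rpow a (p * (real k - real j) / real k)
            * rpow b (p * real j / real k)) = a powr p * poly (square_poly k) t"
    by (simp only: poly_square_poly atMost_atLeast0 sum_distrib_left)
  also have "\<dots> \<le> a powr p * (1 + t powr (real k / p)) powr p"
    using square_poly_le[OF n t] by (intro mult_left_mono) (simp_all add: k_def p_def)
  also have "\<dots> = (a * (1 + b / a)) powr p"
    using ab by (simp add: tb powr_mult)
  also have "a * (1 + b / a) = a + b" using ab by (simp add: field_simps)
  finally show ?thesis using ab by (simp add: rpow_def)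
qed

theorem theorem1:
  fixes k :: nat and a b :: real
  assumes "k > 0" and "a \<ge> 0" and "b \<ge> 0"
  shows "(\<Sum>j = 0..k. (real (k choose j))\<^sup>2
            * rpow a (binom_exponent k * (real k - real j) / real k)
            * rpow b (binom_exponent k * real j / real k))
         \<le> rpow (a + b) (binom_exponent k)"
proof -
  define p where "p = binom_exponent k"
  \<comment> \<open>For \<open>k = 1\<close> the exponent is \<open>1\<close>, hence
    \<open>m = 0\<close>, and both sides equal \<open>a + b\<close>.\<close>
  consider "k = 1" | "k > 1" "a = 0" "b = 0" | "k > 1" "b \<le> a" "a > 0" | "k > 1" "a \<le> b" "b > 0"
    using assms by linarith
  then show ?thesis
  proof cases
    case 1
    then have "{0..k} = {0, 1}" by auto
    then show ?thesis using 1 assms by (simp add: binom_exponent_def rpow_def)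
  next
    case 2
    have "p > 0" using 2 by (simp add: p_def binom_exponent_pos)
    \<comment> \<open>The two exponents never vanish together, so at least one factor is a zero
      power of the ordinary kind.\<close>
    then have "(real (k choose j))\<^sup>2 * rpow a (p * (real k - real j) / real k)
        * rpow b (p * real j / real k) = 0" for j
      using 2 by (simp add: rpow_def)
    then show ?thesis by (simp add: p_def rpow_nonneg del: mult_eq_0_iff)
  next
    case 3
    then show ?thesis using sum_rpow_le_of_le[of "k - 1" b a] assms by simp
  next
    case 4
    \<comment> \<open>Reflecting \<open>j\<close> to \<open>k - j\<close> exchanges the roles of
      \<open>a\<close> and \<open>b\<close>.\<close>
    have "(\<Sum>j = 0..k. (real (k choose j))\<^sup>2
            * rpow a (p * (real k - real j) / real k) * rpow b (p * real j / real k))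
        = (\<Sum>j = 0..k. (real (k choose j))\<^sup>2
            * rpow b (p * (real k - real j) / real k) * rpow a (p * real j / real k))"
      by (rule sum.reindex_bij_witness[of _ "\<lambda>j. k - j" "\<lambda>j. k - j"])
         (auto simp: binomial_symmetric[symmetric] of_nat_diff)
    then show ?thesis
      using sum_rpow_le_of_le[of "k - 1" a b] 4 assms by (simp add: p_def add.commute)
  qed
qed

end
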